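(* The proof system $\mathbf{SC}_{\min}$ is complete with respect to the class of minimal simplicial models, and the proof system $\mathbf{SC}_{\max}$ is complete with respect to the class of maximal simplicial models: every formula of $\mathcal L_D$ true at every world of every minimal (resp. maximal) simplicial model is provable in $\mathbf{SC}_{\min}$ (resp. $\mathbf{SC}_{\max}$).
   Context: Fix a finite set $A$ of agents and a countable set $\mathsf{AP}$. $\mathcal L_D$: $\varphi::=p\mid\neg\varphi\mid\varphi\wedge\varphi\mid D_B\varphi$, $p\in\mathsf{AP}$, $\emptyset\ne B\subseteq A$; $K_a\varphi:=D_{\{a\}}\varphi$, $\mathsf{dead}(a):=K_a\bot$, $\mathsf{alive}(a):=\neg\mathsf{dead}(a)$, $\mathsf{dead}(B):=\bigwedge_{a\in B}\mathsf{dead}(a)$ (empty conjunction $=\top$), $\mathsf{alive}(B):=\neg D_B\bot$, $\overline B=A\setminus B$. $\mathbf{SC}$: propositional tautologies, modus ponens, necessitation (from $\varphi$ infer $D_B\varphi$), and for non-empty $B,B'$: $D_B(\varphi\Rightarrow\psi)\Rightarrow(D_B\varphi\Rightarrow D_B\psi)$; $\varphi\Rightarrow D_B\neg D_B\neg\varphi$; $D_B\varphi\Rightarrow D_BD_B\varphi$; $D_B\varphi\Rightarrow D_{B'}\varphi$ ($B\subseteq B'$); $\mathsf{alive}(B)\wedge\mathsf{alive}(B')\Rightarrow\mathsf{alive}(B\cup B')$; $\bigvee_{a\in A}\mathsf{alive}(a)$; $\mathsf{alive}(B)\wedge\mathsf{dead}(\overline B)\wedge\varphi\Rightarrow D_B(\mathsf{dead}(\overline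 B)\Rightarrow\varphi)$. $\mathbf{SC}_{\min}$ is $\mathbf{SC}$ plus $\mathsf{alive}(B)\wedge\mathsf{dead}(\overline B)\Rightarrow D_B\mathsf{dead}(\overline B)$ for $B\subsetneq A$; $\mathbf{SC}_{\max}$ is $\mathbf{SC}$ plus $\mathsf{alive}(B)\Rightarrow\neg D_B\neg\mathsf{dead}(\overline B)$ for $B\subsetneq A$. A chromatic simplicial complex is $\langle V,S,\chi\rangle$ with $S$ a family of non-empty subsets of $V$ containing all singletons and closed under non-empty subsets, $\chi:V\to A$ injective on each simplex. A generalized simplicial model is $\mathcal C=\langle V,S,\chi,W,\ell\rangle$ with $\mathrm{Facets}\subseteq W\subseteq S$ and $\ell:W\to\mathcal P(\mathsf{AP})$; minimal if $W$ is the set of facets (maximal simplices), maximal if $W=S$. Satisfaction: $\mathcal C,w\models p$ iff $p\in\ell(w)$; boolean clauses standard; $\mathcal C,w\models D_B\varphi$ iff $\mathcal C,w'\models\varphi$ for all $w'\in W$ with $B\subseteq\chi(w\cap w')$. *)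

theory Defs
  imports Main "HOL-Library.Countable_Set"
begin

datatype ('a, 'p) fm =
    Atom 'p
  | Neg "('a, 'p) fm"
  | Con "('a, 'p) fm" "('a, 'p) fm"
  | D "'a set" "('a, 'p) fm"

inductive_set LD :: "'a set \<Rightarrow> 'p set \<Rightarrow> ('a, 'p) fm set"
  for A :: "'a set" and AP :: "'p set" where
  "p \<in> AP \<Longrightarrow> Atom p \<in> LD A AP"
| "\<phi> \<in> LD A AP \<Longrightarrow> Neg \<phi> \<in> LD A AP"
| "\<lbrakk>\<phi> \<in> LD A AP; \<psi> \<in> LD A AP\<rbrakk> \<Longrightarrow> Con \<phi> \<psi> \<in> LD A AP"
| "\<lbrakk>B \<noteq> {}; B \<subseteq> A; \<phi> \<in> LD A AP\<rbrakk> \<Longrightarrow> D B \<phi> \<in> LD A AP"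

definition Dis :: "('a, 'p) fm \<Rightarrow> ('a, 'p) fm \<Rightarrow> ('a, 'p) fm" where
  "Dis \<phi> \<psi> = Neg (Con (Neg \<phi>) (Neg \<psi>))"

definition Imp :: "('a, 'p) fm \<Rightarrow> ('a, 'p) fm \<Rightarrow> ('a, 'p) fm" where
  "Imp \<phi> \<psi> = Neg (Con \<phi> (Neg \<psi>))"

text \<open>Falsity is not primitive: it is \<open>p \<and> \<not>p\<close> for one fixed atom \<open>p\<close> of \<open>AP\<close>.
  If \<open>AP\<close> is empty, the language has no formulas at all.\<close>

definition Fls :: "'p set \<Rightarrow> ('a, 'p) fm" where
  "Fls AP = (let p = (SOME p. p \<in> AP) in Con (Atom p) (Neg (Atom p)))"

definition Tru :: "'p set \<Rightarrow> ('a, 'p) fm" where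
  "Tru AP = Neg (Fls AP)"

fun conj_list :: "'p set \<Rightarrow> ('a, 'p) fm list \<Rightarrow> ('a, 'p) fm" where
  "conj_list AP [] = Tru AP"
| "conj_list AP [\<phi>] = \<phi>"
| "conj_list AP (\<phi> # \<psi> # \<phi>s) = Con \<phi> (conj_list AP (\<psi> # \<phi>s))"

fun disj_list :: "'p set \<Rightarrow> ('a, 'p) fm list \<Rightarrow> ('a, 'p) fm" where
  "disj_list AP [] = Fls AP"
| "disj_list AP [\<phi>] = \<phi>"
| "disj_list AP (\<phi> # \<psi> # \<phi>s) = Dis \<phi> (disj_list AP (\<psi> # \<phi>s))"

text \<open>An arbitrary fixed enumeration of a finite set, used to write conjunctions and
  disjunctions over sets of agents as formulas.\<close>

definition enum_of :: "'b set \<Rightarrow> 'b list" where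
  "enum_of X = (SOME xs. distinct xs \<and> set xs = X)"

definition K :: "'a \<Rightarrow> ('a, 'p) fm \<Rightarrow> ('a, 'p) fm" where
  "K a \<phi> = D {a} \<phi>"

definition dead :: "'p set \<Rightarrow> 'a \<Rightarrow> ('a, 'p) fm" where
  "dead AP a = K a (Fls AP)"

definition alive :: "'p set \<Rightarrow> 'a \<Rightarrow> ('a, 'p) fm" where
  "alive AP a = Neg (dead AP a)"

definition dead_set :: "'p set \<Rightarrow> 'a set \<Rightarrow> ('a, 'p) fm" where
  "dead_set AP B = conj_list AP (map (dead AP) (enum_of B))"

definition alive_set :: "'p set \<Rightarrow> 'a set \<Rightarrow> ('a, 'p) fm" where
  "alive_set AP B = Neg (D B (Fls AP))"

text \<open>Propositional tautologies: true under every truth assignment to the atoms and the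
  formulas \<open>D B \<phi>\<close>, all of which are treated as propositional variables.\<close>

fun peval :: "(('a, 'p) fm \<Rightarrow> bool) \<Rightarrow> ('a, 'p) fm \<Rightarrow> bool" where
  "peval v (Atom p) = v (Atom p)"
| "peval v (Neg \<phi>) = (\<not> peval v \<phi>)"
| "peval v (Con \<phi> \<psi>) = (peval v \<phi> \<and> peval v \<psi>)"
| "peval v (D B \<phi>) = v (D B \<phi>)"

definition tautology :: "('a, 'p) fm \<Rightarrow> bool" where
  "tautology \<phi> \<longleftrightarrow> (\<forall>v. peval v \<phi>)"

inductive_set SC_axioms :: "'a set \<Rightarrow> 'p set \<Rightarrow> ('a, 'p) fm set"
  for A :: "'a set" and AP :: "'p set" where
  Ax_K: "\<lbrakk>B \<noteq> {}; B \<subseteq> A; \<phi> \<in> LD A AP; \<psi> \<in> LD A AP\<rbrakk> \<Longrightarrow>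
    Imp (D B (Imp \<phi> \<psi>)) (Imp (D B \<phi>) (D B \<psi>)) \<in> SC_axioms A AP"
| Ax_B: "\<lbrakk>B \<noteq> {}; B \<subseteq> A; \<phi> \<in> LD A AP\<rbrakk> \<Longrightarrow>
    Imp \<phi> (D B (Neg (D B (Neg \<phi>)))) \<in> SC_axioms A AP"
| Ax_4: "\<lbrakk>B \<noteq> {}; B \<subseteq> A; \<phi> \<in> LD A AP\<rbrakk> \<Longrightarrow>
    Imp (D B \<phi>) (D B (D B \<phi>)) \<in> SC_axioms A AP"
| Ax_Mono: "\<lbrakk>B \<noteq> {}; B \<subseteq> B'; B' \<subseteq> A; \<phi> \<in> LD A AP\<rbrakk> \<Longrightarrow>
    Imp (D B \<phi>) (D B' \<phi>) \<in> SC_axioms A AP"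
| Ax_Union: "\<lbrakk>B \<noteq> {}; B \<subseteq> A; B' \<noteq> {}; B' \<subseteq> A\<rbrakk> \<Longrightarrow>
    Imp (Con (alive_set AP B) (alive_set AP B')) (alive_set AP (B \<union> B')) \<in> SC_axioms A AP"
| Ax_NE: "disj_list AP (map (alive AP) (enum_of A)) \<in> SC_axioms A AP"
| Ax_P: "\<lbrakk>B \<noteq> {}; B \<subseteq> A; \<phi> \<in> LD A AP\<rbrakk> \<Longrightarrow>
    Imp (Con (alive_set AP B) (Con (dead_set AP (A - B)) \<phi>))
        (D B (Imp (dead_set AP (A - B)) \<phi>)) \<in> SC_axioms A AP"

definition Min_axioms :: "'a set \<Rightarrow> 'p set \<Rightarrow> ('a, 'p) fm set" where
  "Min_axioms A AP =
    {Imp (Con (alive_set AP B) (dead_set AP (A - B))) (D B (dead_set AP (A - B))) |B.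
      B \<noteq> {} \<and> B \<subset> A}"

definition Max_axioms :: "'a set \<Rightarrow> 'p set \<Rightarrow> ('a, 'p) fm set" where
  "Max_axioms A AP =
    {Imp (alive_set AP B) (Neg (D B (Neg (dead_set AP (A - B))))) |B.
      B \<noteq> {} \<and> B \<subset> A}"

inductive_set theorems_of :: "'a set \<Rightarrow> 'p set \<Rightarrow> ('a, 'p) fm set \<Rightarrow> ('a, 'p) fm set"
  for A :: "'a set" and AP :: "'p set" and Ax :: "('a, 'p) fm set" where
  Taut: "\<lbrakk>\<phi> \<in> LD A AP; tautology \<phi>\<rbrakk> \<Longrightarrow> \<phi> \<in> theorems_of A AP Ax"
| Axiom: "\<phi> \<in> Ax \<Longrightarrow> \<phi> \<in> theorems_of A AP Ax"
| MP: "\<lbrakk>\<phi> \<in> theorems_of A AP Ax; Imp \<phi> \<psi> \<in> theorems_of A AP Ax\<rbrakk> \<Longrightarrow> \<psi> \<in> theorems_of A AP Ax"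
| Nec: "\<lbrakk>\<phi> \<in> theorems_of A AP Ax; B \<noteq> {}; B \<subseteq> A\<rbrakk> \<Longrightarrow> D B \<phi> \<in> theorems_of A AP Ax"

definition SC_min :: "'a set \<Rightarrow> 'p set \<Rightarrow> ('a, 'p) fm set" where
  "SC_min A AP = theorems_of A AP (SC_axioms A AP \<union> Min_axioms A AP)"

definition SC_max :: "'a set \<Rightarrow> 'p set \<Rightarrow> ('a, 'p) fm set" where
  "SC_max A AP = theorems_of A AP (SC_axioms A AP \<union> Max_axioms A AP)"

definition chromatic_complex :: "'a set \<Rightarrow> 'v set \<Rightarrow> 'v set set \<Rightarrow> ('v \<Rightarrow> 'a) \<Rightarrow> bool" where
  "chromatic_complex A V S \<chi> \<longleftrightarrow>
    (\<forall>X\<in>S. X \<noteq> {} \<and> X \<subseteq> V) \<and>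
    (\<forall>v\<in>V. {v} \<in> S) \<and>
    (\<forall>X\<in>S. \<forall>Y. Y \<noteq> {} \<and> Y \<subseteq> X \<longrightarrow> Y \<in> S) \<and>
    \<chi> ` V \<subseteq> A \<and>
    (\<forall>X\<in>S. inj_on \<chi> X)"

definition facets :: "'v set set \<Rightarrow> 'v set set" where
  "facets S = {X \<in> S. \<forall>Y\<in>S. X \<subseteq> Y \<longrightarrow> Y = X}"

record ('a, 'p, 'v) simp_model =
  vertices :: "'v set"
  simplices :: "'v set set"
  colour :: "'v \<Rightarrow> 'a"
  worlds :: "'v set set"
  label :: "'v set \<Rightarrow> 'p set"

definition generalized_model :: "'a set \<Rightarrow> 'p set \<Rightarrow> ('a, 'p, 'v) simp_model \<Rightarrow> bool" where
  "generalized_model A AP C \<longleftrightarrow>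
    chromatic_complex A (vertices C) (simplices C) (colour C) \<and>
    facets (simplices C) \<subseteq> worlds C \<and> worlds C \<subseteq> simplices C \<and>
    (\<forall>w\<in>worlds C. label C w \<subseteq> AP)"

definition minimal_model :: "'a set \<Rightarrow> 'p set \<Rightarrow> ('a, 'p, 'v) simp_model \<Rightarrow> bool" where
  "minimal_model A AP C \<longleftrightarrow> generalized_model A AP C \<and> worlds C = facets (simplices C)"

definition maximal_model :: "'a set \<Rightarrow> 'p set \<Rightarrow> ('a, 'p, 'v) simp_model \<Rightarrow> bool" where
  "maximal_model A AP C \<longleftrightarrow> generalized_model A AP C \<and> worlds C = simplices C"

fun sat :: "('a, 'p, 'v) simp_model \<Rightarrow> 'v set \<Rightarrow> ('a, 'p) fm \<Rightarrow> bool" where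
  "sat C w (Atom p) \<longleftrightarrow> p \<in> label C w"
| "sat C w (Neg \<phi>) \<longleftrightarrow> \<not> sat C w \<phi>"
| "sat C w (Con \<phi> \<psi>) \<longleftrightarrow> sat C w \<phi> \<and> sat C w \<psi>"
| "sat C w (D B \<phi>) \<longleftrightarrow> (\<forall>w'\<in>worlds C. B \<subseteq> colour C ` (w \<inter> w') \<longrightarrow> sat C w' \<phi>)"

end

theory Submission
  imports Defs "HOL-Library.Sublist"
begin

text \<open>The canonical relation of \<open>D B\<close> need not be the intersection of those of its members, so
  the canonical frame is unravelled into a tree whose nodes carry maximal consistent theories and
  whose edges carry groups of agents: an edge \<open>(B, \<phi>)\<close> leads to a witness for \<open>\<not> D B \<phi>\<close>.
  Two nodes share the vertex of an agent \<open>a\<close> if all edges on the path between them contain \<open>a\<close>;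
  as paths in a tree are unique, sharing the vertices of all agents of \<open>B\<close> means that all these
  edges contain \<open>B\<close>, which gives the canonical relation of \<open>D B\<close>. The axiom
  \<open>alive(B) \<and> dead(A - B) \<and> \<phi> \<Rightarrow> D B (dead(A - B) \<Rightarrow> \<phi>)\<close>
  makes the theory of a node a function of its set of live vertices. The additional axiom of
  \<open>SC_min\<close> forbids a world from being properly contained in another one, and that of
  \<open>SC_max\<close> yields, for every face of a world, a witness whose world is that face.
  The tree has only countably many nodes, hence fits into any infinite vertex type.\<close>

section \<open>Formulas\<close>

inductive_cases LD_NegE: "Neg \<phi> \<in> LD A AP"
inductive_cases LD_ConE: "Con \<phi> \<psi> \<in> LD A AP"
inductive_cases LD_DE: "D B \<phi> \<in> LD A AP"

lemma Neg_LD_iff [simp]: "Neg \<phi> \<in> LD A AP \<longleftrightarrow> \<phi> \<in> LD A AP"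
  by (auto intro: LD.intros elim: LD_NegE)

lemma Con_LD_iff [simp]: "Con \<phi> \<psi> \<in> LD A AP \<longleftrightarrow> \<phi> \<in> LD A AP \<and> \<psi> \<in> LD A AP"
  by (auto intro: LD.intros elim: LD_ConE)

lemma D_LD_iff [simp]: "D B \<phi> \<in> LD A AP \<longleftrightarrow> B \<noteq> {} \<and> B \<subseteq> A \<and> \<phi> \<in> LD A AP"
  by (auto intro: LD.intros elim: LD_DE)

lemma Imp_LD_iff [simp]: "Imp \<phi> \<psi> \<in> LD A AP \<longleftrightarrow> \<phi> \<in> LD A AP \<and> \<psi> \<in> LD A AP"
  by (simp add: Imp_def)

lemma Dis_LD_iff [simp]: "Dis \<phi> \<psi> \<in> LD A AP \<longleftrightarrow> \<phi> \<in> LD A AP \<and> \<psi> \<in> LD A AP"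
  by (simp add: Dis_def)

lemma peval_Imp [simp]: "peval v (Imp \<phi> \<psi>) \<longleftrightarrow> (peval v \<phi> \<longrightarrow> peval v \<psi>)"
  by (simp add: Imp_def)

lemma AP_nonempty_if_LD: "\<phi> \<in> LD A AP \<Longrightarrow> AP \<noteq> {}"
  by (induction rule: LD.induct) auto

lemma set_enum_of [simp]: "finite X \<Longrightarrow> set (enum_of X) = X"
  unfolding enum_of_def by (rule someI2_ex) (auto dest: finite_distinct_list)

text \<open>The leading tag determines the constructor and hence how many subformulas follow, so no
  brackets are coded. Groups are numbered through \<open>Pow A\<close>, which is countable once
  \<open>A\<close> is finite.\<close>

fun fm_code :: "'a set \<Rightarrow> 'p set \<Rightarrow> ('a, 'p) fm \<Rightarrow> nat list" where
  "fm_code A AP (Atom p) = [0, to_nat_on AP p]"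
| "fm_code A AP (Neg \<phi>) = 1 # fm_code A AP \<phi>"
| "fm_code A AP (Con \<phi> \<psi>) = 2 # fm_code A AP \<phi> @ fm_code A AP \<psi>"
| "fm_code A AP (D B \<phi>) = 3 # to_nat_on (Pow A) B # fm_code A AP \<phi>"

text \<open>Prefix-freeness of the code is what the induction needs.\<close>

lemma fm_code_prefix_free:
  assumes "finite A" "countable AP"
  shows "\<phi> \<in> LD A AP \<Longrightarrow> \<psi> \<in> LD A AP \<Longrightarrow>
    fm_code A AP \<phi> @ xs = fm_code A AP \<psi> @ ys \<Longrightarrow> \<phi> = \<psi> \<and> xs = ys"
proof (induction \<phi> arbitrary: \<psi> xs ys rule: LD.induct)
  case (1 p)
  from 1(2,1,3) show ?case using assms(2) by cases auto
next
  case (2 \<phi>)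
  from 2(3) show ?case
  proof cases
    case (2 \<phi>')
    then show ?thesis using "2.IH"[of \<phi>' xs ys] "2.prems" by auto
  qed (use 2(4) in auto)
next
  case (3 \<phi>1 \<phi>2)
  from 3(5) show ?case
  proof cases
    case (3 \<psi>1 \<psi>2)
    with "3.prems" have "fm_code A AP \<phi>1 @ fm_code A AP \<phi>2 @ xs = fm_code A AP \<psi>1 @ fm_code A AP \<psi>2 @ ys"
      by simp
    from "3.IH"(1)[OF _ this] 3 "3.IH"(2)[of \<psi>2 xs ys] show ?thesis by auto
  qed (use 3(6) in auto)
next
  case (4 B \<phi>)
  have cP: "countable (Pow A)" using assms(1) by (simp add: countable_finite)
  from 4(5) show ?case
  proof cases
    case (4 B' \<phi>')
    then show ?thesis using "4.IH"[of \<phi>' xs ys] "4.prems" "4.hyps" cP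
      by (auto simp: to_nat_on_inj)
  qed (use 4(6) in auto)
qed

lemma countable_LD:
  assumes "finite A" "countable AP"
  shows "countable (LD A AP)"
proof (rule countableI')
  show "inj_on (to_nat \<circ> fm_code A AP) (LD A AP)"
    using fm_code_prefix_free[OF assms, of _ _ "[]" "[]"] by (auto intro!: inj_onI)
qed

section \<open>Maximal consistent theories\<close>

text \<open>Leaving \<open>Ax\<close> open above \<open>SC_axioms\<close> covers both systems at
  once. A non-empty \<open>AP\<close> is what makes \<open>Fls AP\<close> a formula of the
  language.\<close>

locale SC_logic =
  fixes A :: "'a set" and AP :: "'p set" and Ax :: "('a, 'p) fm set"
  assumes finite_agents: "finite A" and atoms_nonempty: "AP \<noteq> {}"
    and SC_axioms_subset: "SC_axioms A AP \<subseteq> Ax"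
begin

abbreviation thms :: "('a, 'p) fm set" where
  "thms \<equiv> theorems_of A AP Ax"

lemma Fls_LD [simp]: "Fls AP \<in> LD A AP"
  using atoms_nonempty by (auto simp: Fls_def Let_def some_in_eq intro: LD.intros)

lemma Tru_LD [simp]: "Tru AP \<in> LD A AP"
  by (simp add: Tru_def)

lemma conj_list_LD: "set \<phi>s \<subseteq> LD A AP \<Longrightarrow> conj_list AP \<phi>s \<in> LD A AP"
  by (induction \<phi>s rule: induct_list012) auto

lemma disj_list_LD: "set \<phi>s \<subseteq> LD A AP \<Longrightarrow> disj_list AP \<phi>s \<in> LD A AP"
  by (induction \<phi>s rule: induct_list012) auto

lemma alive_LD [simp]: "a \<in> A \<Longrightarrow> alive AP a \<in> LD A AP"
  by (simp add: alive_def dead_def K_def)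

lemma dead_LD [simp]: "a \<in> A \<Longrightarrow> dead AP a \<in> LD A AP"
  by (simp add: dead_def K_def)

lemma alive_set_LD [simp]: "B \<noteq> {} \<Longrightarrow> B \<subseteq> A \<Longrightarrow> alive_set AP B \<in> LD A AP"
  by (simp add: alive_set_def)

lemma dead_set_LD [simp]: "B \<subseteq> A \<Longrightarrow> dead_set AP B \<in> LD A AP"
  unfolding dead_set_def using finite_subset[OF _ finite_agents, of B]
  by (intro conj_list_LD) auto

text \<open>Closure is under modus ponens only: necessitation preserves validity, not truth at a
  single world. Theorems are cut down to the language because \<open>Ax\<close> is arbitrary and may
  leave it.\<close>

definition is_theory :: "('a, 'p) fm set \<Rightarrow> bool" where
  "is_theory T \<longleftrightarrow> T \<subseteq> LD A AP \<and> thms \<inter> LD A AP \<subseteq> T \<and>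
    (\<forall>\<phi> \<psi>. \<phi> \<in> T \<longrightarrow> Imp \<phi> \<psi> \<in> T \<longrightarrow> \<psi> \<in> T)"

definition mcs :: "('a, 'p) fm set \<Rightarrow> bool" where
  "mcs \<Gamma> \<longleftrightarrow> is_theory \<Gamma> \<and> (\<forall>\<phi>\<in>LD A AP. Neg \<phi> \<in> \<Gamma> \<longleftrightarrow> \<phi> \<notin> \<Gamma>)"

lemma theory_LD: "is_theory T \<Longrightarrow> \<phi> \<in> T \<Longrightarrow> \<phi> \<in> LD A AP"
  by (auto simp: is_theory_def)

lemma theory_thm: "is_theory T \<Longrightarrow> \<phi> \<in> thms \<Longrightarrow> \<phi> \<in> LD A AP \<Longrightarrow> \<phi> \<in> T"
  by (auto simp: is_theory_def)

lemma theory_mp: "is_theory T \<Longrightarrow> Imp \<phi> \<psi> \<in> T \<Longrightarrow> \<phi> \<in> T \<Longrightarrow> \<psi> \<in> T"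
  unfolding is_theory_def by blast

lemma theory_taut: "is_theory T \<Longrightarrow> \<phi> \<in> LD A AP \<Longrightarrow> tautology \<phi> \<Longrightarrow> \<phi> \<in> T"
  by (auto intro: theory_thm theorems_of.Taut)

lemma theory_taut1:
  "is_theory T \<Longrightarrow> \<phi> \<in> T \<Longrightarrow> \<psi> \<in> LD A AP \<Longrightarrow> tautology (Imp \<phi> \<psi>) \<Longrightarrow> \<psi> \<in> T"
  by (meson Imp_LD_iff theory_LD theory_mp theory_taut)

lemma theory_taut2:
  "is_theory T \<Longrightarrow> \<phi> \<in> T \<Longrightarrow> \<psi> \<in> T \<Longrightarrow> \<chi> \<in> LD A AP \<Longrightarrow> tautology (Imp \<phi> (Imp \<psi> \<chi>)) \<Longrightarrow> \<chi> \<in> T"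
  by (meson Imp_LD_iff theory_LD theory_mp theory_taut1)

lemma theory_thms: "is_theory (thms \<inter> LD A AP)"
  unfolding is_theory_def by (auto intro: theorems_of.MP)

text \<open>By the deduction theorem this set is the closure of \<open>T\<close> together with
  \<open>\<psi>\<close>; describing it by implications avoids derivations from hypotheses.\<close>

lemma theory_adjoin:
  assumes "is_theory T" "\<psi> \<in> LD A AP"
  shows "is_theory {\<chi> \<in> LD A AP. Imp \<psi> \<chi> \<in> T}"
proof -
  have "Imp \<psi> \<chi> \<in> T" if "\<chi> \<in> T" for \<chi>
    by (rule theory_taut1[OF assms(1) that]) (use assms that theory_LD in \<open>auto simp: tautology_def\<close>)
  moreover have "Imp \<psi> \<chi> \<in> T" if "Imp \<psi> \<phi> \<in> T" "Imp \<psi> (Imp \<phi> \<chi>) \<in> T" for \<phi> \<chi>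
    by (rule theory_taut2[OF assms(1) that]) (use theory_LD[OF assms(1) that(2)] in \<open>auto simp: tautology_def\<close>)
  ultimately show ?thesis
    using theory_LD[OF assms(1)] theory_thm[OF assms(1)] unfolding is_theory_def by auto
qed

text \<open>Zorn's lemma yields a theory maximal among those that extend \<open>T\<close> and omit
  \<open>\<phi>\<close>. Omitting \<open>\<phi>\<close> plays the part of consistency, and
  maximality gives negation completeness.\<close>

lemma lindenbaum:
  assumes T: "is_theory T" and \<phi>: "\<phi> \<in> LD A AP" "\<phi> \<notin> T"
  obtains \<Gamma> where "mcs \<Gamma>" "T \<subseteq> \<Gamma>" "\<phi> \<notin> \<Gamma>"
proof -
  let ?F = "{U. is_theory U \<and> T \<subseteq> U \<and> \<phi> \<notin> U}"
  have "\<exists>M\<in>?F. \<forall>X\<in>?F. M \<subseteq> X \<longrightarrow> X = M"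
  proof (rule subset_Zorn_nonempty)
    show "?F \<noteq> {}" using T \<phi> by auto
    fix \<C> assume "\<C> \<noteq> {}" and ch: "subset.chain ?F \<C>"
    then have F: "\<And>U. U \<in> \<C> \<Longrightarrow> is_theory U \<and> T \<subseteq> U \<and> \<phi> \<notin> U"
      by (auto simp: subset_chain_def)
    \<comment> \<open>The premises may come from two members of the chain; the larger one contains
      both.\<close>
    have mp: "\<psi> \<in> \<Union>\<C>" if "\<chi> \<in> U" "U \<in> \<C>" "Imp \<chi> \<psi> \<in> U'" "U' \<in> \<C>" for \<chi> \<psi> U U'
    proof -
      have "U \<subseteq> U' \<or> U' \<subseteq> U" using ch that by (auto simp: subset_chain_def)
      then show ?thesis using that F theory_mp by (metis Union_iff subsetD)
    qed
    have "is_theory (\<Union>\<C>)"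
      unfolding is_theory_def
    proof (intro conjI allI impI)
      show "\<Union>\<C> \<subseteq> LD A AP" using F theory_LD by blast
      show "thms \<inter> LD A AP \<subseteq> \<Union>\<C>" using F \<open>\<C> \<noteq> {}\<close> theory_thm by blast
    qed (use mp in blast)
    then show "\<Union>\<C> \<in> ?F" using F \<open>\<C> \<noteq> {}\<close> by auto
  qed
  then obtain M where M: "is_theory M" "T \<subseteq> M" "\<phi> \<notin> M"
    and max: "\<And>X. is_theory X \<Longrightarrow> \<phi> \<notin> X \<Longrightarrow> M \<subseteq> X \<Longrightarrow> X = M"
    by auto
  \<comment> \<open>Otherwise adjoining \<open>\<psi>\<close> would give a theory that still omits
    \<open>\<phi>\<close>; by maximality it is \<open>M\<close>, so \<open>\<psi>\<close> would lie
    in \<open>M\<close>.\<close>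
  have adj: "Imp \<psi> \<phi> \<in> M" if "\<psi> \<in> LD A AP" "\<psi> \<notin> M" for \<psi>
  proof (rule ccontr)
    assume *: "Imp \<psi> \<phi> \<notin> M"
    let ?X = "{\<chi> \<in> LD A AP. Imp \<psi> \<chi> \<in> M}"
    have "Imp \<psi> \<chi> \<in> M" if "\<chi> \<in> M" for \<chi>
      by (rule theory_taut1[OF M(1) that])
        (use \<open>\<psi> \<in> LD A AP\<close> theory_LD[OF M(1) that] in \<open>auto simp: tautology_def\<close>)
    then have "M \<subseteq> ?X" using theory_LD[OF M(1)] by auto
    then have "?X = M" using * that(1) by (intro max theory_adjoin M) auto
    moreover have "\<psi> \<in> ?X"
      using that(1) theory_taut[OF M(1), of "Imp \<psi> \<psi>"] by (simp add: tautology_def)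
    ultimately show False using that by blast
  qed
  have "Neg \<psi> \<in> M \<longleftrightarrow> \<psi> \<notin> M" if \<psi>: "\<psi> \<in> LD A AP" for \<psi>
  proof
    assume "Neg \<psi> \<in> M"
    then show "\<psi> \<notin> M"
      using theory_taut2[OF M(1), of \<psi> "Neg \<psi>" \<phi>] M(3) \<phi>(1) by (auto simp: tautology_def)
  next
    assume "\<psi> \<notin> M"
    \<comment> \<open>If \<open>Neg \<psi>\<close> were missing as well, both \<open>\<psi>\<close>
      and \<open>Neg \<psi>\<close> would imply \<open>\<phi>\<close> in \<open>M\<close>, which
      would put \<open>\<phi>\<close> into \<open>M\<close>.\<close>
    then show "Neg \<psi> \<in> M"
      using theory_taut2[OF M(1) adj[of \<psi>] adj[of "Neg \<psi>"], of \<phi>] M(3) \<phi>(1) \<psi>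
      by (auto simp: tautology_def)
  qed
  then have "mcs M" using M by (auto simp: mcs_def)
  then show ?thesis using that M by blast
qed

section \<open>Connectives and axioms in maximal consistent sets\<close>

lemma mcs_theory: "mcs \<Gamma> \<Longrightarrow> is_theory \<Gamma>"
  by (simp add: mcs_def)

lemma mcs_LD: "mcs \<Gamma> \<Longrightarrow> \<phi> \<in> \<Gamma> \<Longrightarrow> \<phi> \<in> LD A AP"
  using mcs_theory theory_LD by blast

lemma mcs_Neg: "mcs \<Gamma> \<Longrightarrow> \<phi> \<in> LD A AP \<Longrightarrow> Neg \<phi> \<in> \<Gamma> \<longleftrightarrow> \<phi> \<notin> \<Gamma>"
  by (simp add: mcs_def)

lemma mcs_Con:
  assumes "mcs \<Gamma>"
  shows "Con \<phi> \<psi> \<in> \<Gamma> \<longleftrightarrow> \<phi> \<in> \<Gamma> \<and> \<psi> \<in> \<Gamma>"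
proof
  assume "Con \<phi> \<psi> \<in> \<Gamma>"
  then show "\<phi> \<in> \<Gamma> \<and> \<psi> \<in> \<Gamma>"
    using mcs_LD[OF assms] theory_taut1[OF mcs_theory[OF assms], of "Con \<phi> \<psi>"]
    by (fastforce simp: tautology_def)
next
  assume "\<phi> \<in> \<Gamma> \<and> \<psi> \<in> \<Gamma>"
  then show "Con \<phi> \<psi> \<in> \<Gamma>"
    using mcs_LD[OF assms] theory_taut2[OF mcs_theory[OF assms], of \<phi> \<psi> "Con \<phi> \<psi>"]
    by (auto simp: tautology_def)
qed

lemma mcs_Imp:
  assumes "mcs \<Gamma>" "\<phi> \<in> LD A AP" "\<psi> \<in> LD A AP"
  shows "Imp \<phi> \<psi> \<in> \<Gamma> \<longleftrightarrow> (\<phi> \<in> \<Gamma> \<longrightarrow> \<psi> \<in> \<Gamma>)"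
  using assms by (simp add: Imp_def mcs_Neg mcs_Con)

lemma mcs_Dis:
  assumes "mcs \<Gamma>" "\<phi> \<in> LD A AP" "\<psi> \<in> LD A AP"
  shows "Dis \<phi> \<psi> \<in> \<Gamma> \<longleftrightarrow> \<phi> \<in> \<Gamma> \<or> \<psi> \<in> \<Gamma>"
  using assms by (simp add: Dis_def mcs_Neg mcs_Con)

lemma mcs_Fls: "mcs \<Gamma> \<Longrightarrow> Fls AP \<notin> \<Gamma>"
  using Fls_LD by (auto simp: Fls_def Let_def mcs_Con mcs_Neg)

lemma mcs_conj_list:
  assumes "mcs \<Gamma>"
  shows "set \<phi>s \<subseteq> LD A AP \<Longrightarrow> conj_list AP \<phi>s \<in> \<Gamma> \<longleftrightarrow> set \<phi>s \<subseteq> \<Gamma>"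
  by (induction \<phi>s rule: induct_list012)
    (use assms in \<open>auto simp: mcs_Con Tru_def mcs_Neg mcs_Fls\<close>)

lemma mcs_disj_list:
  assumes "mcs \<Gamma>"
  shows "set \<phi>s \<subseteq> LD A AP \<Longrightarrow> disj_list AP \<phi>s \<in> \<Gamma> \<longleftrightarrow> set \<phi>s \<inter> \<Gamma> \<noteq> {}"
proof (induction \<phi>s rule: induct_list012)
  case (3 \<phi> \<psi> \<phi>s)
  then have "disj_list AP (\<psi> # \<phi>s) \<in> LD A AP" by (intro disj_list_LD) auto
  with 3 show ?case using assms by (auto simp: mcs_Dis)
qed (use assms in \<open>auto simp: mcs_Fls\<close>)

lemma mcs_axiom: "mcs \<Gamma> \<Longrightarrow> \<phi> \<in> Ax \<Longrightarrow> \<phi> \<in> LD A AP \<Longrightarrow> \<phi> \<in> \<Gamma>"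
  by (auto intro: theory_thm mcs_theory theorems_of.Axiom)

lemma mcs_SC_axiom: "mcs \<Gamma> \<Longrightarrow> \<phi> \<in> SC_axioms A AP \<Longrightarrow> \<phi> \<in> LD A AP \<Longrightarrow> \<phi> \<in> \<Gamma>"
  using mcs_axiom SC_axioms_subset by blast

lemma mcs_D_mp:
  assumes "mcs \<Gamma>" "D B (Imp \<phi> \<psi>) \<in> \<Gamma>" "D B \<phi> \<in> \<Gamma>"
  shows "D B \<psi> \<in> \<Gamma>"
proof -
  have B: "B \<noteq> {}" "B \<subseteq> A" "\<phi> \<in> LD A AP" "\<psi> \<in> LD A AP"
    using assms(2) mcs_LD[OF assms(1)] by fastforce+
  then have "Imp (D B (Imp \<phi> \<psi>)) (Imp (D B \<phi>) (D B \<psi>)) \<in> \<Gamma>"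
    by (intro mcs_SC_axiom[OF assms(1) Ax_K]) auto
  then show ?thesis
    using assms B by (simp add: mcs_Imp)
qed

section \<open>Canonical relations\<close>

definition canon :: "'a set \<Rightarrow> ('a, 'p) fm set \<Rightarrow> ('a, 'p) fm set \<Rightarrow> bool" where
  "canon B \<Gamma> \<Delta> \<longleftrightarrow> (\<forall>\<phi>. D B \<phi> \<in> \<Gamma> \<longrightarrow> \<phi> \<in> \<Delta>)"

definition live :: "('a, 'p) fm set \<Rightarrow> 'a set" where
  "live \<Gamma> = {a \<in> A. alive AP a \<in> \<Gamma>}"

lemma live_subset: "live \<Gamma> \<subseteq> A"
  by (auto simp: live_def)

text \<open>The formulas known to \<open>B\<close> in \<open>\<Gamma>\<close> form a theory by axiom
  K and necessitation. It omits \<open>\<phi>\<close>, so \<open>lindenbaum\<close> applies.\<close>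

lemma canon_witness:
  assumes \<Gamma>: "mcs \<Gamma>" and B: "B \<noteq> {}" "B \<subseteq> A" and \<phi>: "\<phi> \<in> LD A AP" "D B \<phi> \<notin> \<Gamma>"
  obtains \<Delta> where "mcs \<Delta>" "canon B \<Gamma> \<Delta>" "\<phi> \<notin> \<Delta>"
proof -
  let ?T = "{\<chi> \<in> LD A AP. D B \<chi> \<in> \<Gamma>}"
  have "is_theory ?T"
    unfolding is_theory_def
  proof (intro conjI subsetI allI impI)
    fix \<chi> assume "\<chi> \<in> thms \<inter> LD A AP"
    then show "\<chi> \<in> ?T"
      using B theory_thm[OF mcs_theory[OF \<Gamma>], of "D B \<chi>"] theorems_of.Nec[of \<chi> A AP Ax B] by auto
  qed (use \<Gamma> in \<open>auto intro: mcs_D_mp\<close>)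
  moreover have "\<phi> \<notin> ?T" using \<phi> by simp
  ultimately obtain \<Delta> where \<Delta>: "mcs \<Delta>" "?T \<subseteq> \<Delta>" "\<phi> \<notin> \<Delta>"
    using lindenbaum \<phi>(1) by blast
  have "\<chi> \<in> \<Delta>" if "D B \<chi> \<in> \<Gamma>" for \<chi>
    using \<Delta>(2) that mcs_LD[OF \<Gamma> that] by auto
  then show ?thesis
    using that \<Delta> unfolding canon_def by blast
qed

lemma canon_sym:
  assumes \<Gamma>: "mcs \<Gamma>" and \<Delta>: "mcs \<Delta>" and can: "canon B \<Gamma> \<Delta>"
  shows "canon B \<Delta> \<Gamma>"
  unfolding canon_def
proof (intro allI impI, rule ccontr)
  fix \<phi> assume D: "D B \<phi> \<in> \<Delta>" and "\<phi> \<notin> \<Gamma>"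
  have B: "B \<noteq> {}" "B \<subseteq> A" "\<phi> \<in> LD A AP" using mcs_LD[OF \<Delta> D] by auto
  with \<open>\<phi> \<notin> \<Gamma>\<close> \<Gamma> have "Neg \<phi> \<in> \<Gamma>" by (simp add: mcs_Neg)
  moreover have "Imp (Neg \<phi>) (D B (Neg (D B (Neg (Neg \<phi>))))) \<in> \<Gamma>"
    using B by (intro mcs_SC_axiom[OF \<Gamma> Ax_B]) auto
  ultimately have "Neg (D B (Neg (Neg \<phi>))) \<in> \<Delta>"
    using can B \<Gamma> by (simp add: mcs_Imp canon_def)
  \<comment> \<open>The instance of \<open>Ax_B\<close> for \<open>Neg \<phi>\<close> mentions a
    double negation, so \<open>D B \<phi>\<close> has to be brought into that form under the
    modality.\<close>
  moreover have "D B (Imp \<phi> (Neg (Neg \<phi>))) \<in> \<Delta>"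
    using B by (intro theory_thm[OF mcs_theory[OF \<Delta>]] theorems_of.Nec theorems_of.Taut)
      (auto simp: tautology_def)
  then have "D B (Neg (Neg \<phi>)) \<in> \<Delta>" using mcs_D_mp[OF \<Delta> _ D] by blast
  ultimately show False using B \<Delta> by (simp add: mcs_Neg)
qed

lemma canon_trans:
  assumes \<Gamma>: "mcs \<Gamma>" and "canon B \<Gamma> \<Delta>" "canon B \<Delta> \<Theta>"
  shows "canon B \<Gamma> \<Theta>"
  unfolding canon_def
proof (intro allI impI)
  fix \<phi> assume D: "D B \<phi> \<in> \<Gamma>"
  have B: "B \<noteq> {}" "B \<subseteq> A" "\<phi> \<in> LD A AP" using mcs_LD[OF \<Gamma> D] by auto
  then have "Imp (D B \<phi>) (D B (D B \<phi>)) \<in> \<Gamma>"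
    by (intro mcs_SC_axiom[OF \<Gamma> Ax_4]) auto
  then show "\<phi> \<in> \<Theta>" using assms B D by (simp add: mcs_Imp canon_def)
qed

lemma mcs_D_mono:
  assumes \<Gamma>: "mcs \<Gamma>" and C: "B \<subseteq> C" "C \<subseteq> A" and D: "D B \<phi> \<in> \<Gamma>"
  shows "D C \<phi> \<in> \<Gamma>"
proof -
  have B: "B \<noteq> {}" "\<phi> \<in> LD A AP" using mcs_LD[OF \<Gamma> D] by auto
  then have "Imp (D B \<phi>) (D C \<phi>) \<in> \<Gamma>"
    using C by (intro mcs_SC_axiom[OF \<Gamma> Ax_Mono]) auto
  then show ?thesis using D theory_mp[OF mcs_theory[OF \<Gamma>]] by blast
qed

lemma canon_antimono:
  "mcs \<Gamma> \<Longrightarrow> canon C \<Gamma> \<Delta> \<Longrightarrow> B \<subseteq> C \<Longrightarrow> C \<subseteq> A \<Longrightarrow> canon B \<Gamma> \<Delta>"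
  using mcs_D_mono by (auto simp: canon_def)

text \<open>Monotonicity passes from the group to its members; \<open>Ax_Union\<close>, adding one
  agent at a time, passes from the members to the group.\<close>

lemma mcs_alive_set:
  assumes \<Gamma>: "mcs \<Gamma>" and B: "B \<noteq> {}" "B \<subseteq> A"
  shows "alive_set AP B \<in> \<Gamma> \<longleftrightarrow> B \<subseteq> live \<Gamma>"
proof
  assume *: "alive_set AP B \<in> \<Gamma>"
  show "B \<subseteq> live \<Gamma>"
  proof
    fix a assume "a \<in> B"
    then have "D {a} (Fls AP) \<notin> \<Gamma>"
      using * B \<Gamma> mcs_D_mono[OF \<Gamma>, of "{a}" B "Fls AP"] by (auto simp: alive_set_def mcs_Neg)
    moreover have "a \<in> A" using \<open>a \<in> B\<close> B by auto
    ultimately show "a \<in> live \<Gamma>"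
      using \<Gamma> by (simp add: live_def alive_def dead_def K_def mcs_Neg)
  qed
next
  have "finite B" using B finite_agents finite_subset by blast
  then have "B \<noteq> {} \<Longrightarrow> B \<subseteq> A \<Longrightarrow> B \<subseteq> live \<Gamma> \<Longrightarrow> alive_set AP B \<in> \<Gamma>"
  proof (induction rule: finite_induct)
    case (insert a B)
    have a: "alive_set AP {a} \<in> \<Gamma>"
      using insert.prems by (simp add: live_def alive_def dead_def K_def alive_set_def)
    show ?case
    proof (cases "B = {}")
      case False
      then have "alive_set AP B \<in> \<Gamma>" using insert by auto
      moreover have "Imp (Con (alive_set AP {a}) (alive_set AP B)) (alive_set AP ({a} \<union> B)) \<in> \<Gamma>"
        using False insert.prems by (intro mcs_SC_axiom[OF \<Gamma> Ax_Union]) auto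
      ultimately have "alive_set AP ({a} \<union> B) \<in> \<Gamma>"
        using a theory_mp[OF mcs_theory[OF \<Gamma>]] \<Gamma> by (metis mcs_Con)
      then show ?thesis by simp
    qed (use a in simp)
  qed simp
  then show "B \<subseteq> live \<Gamma> \<Longrightarrow> alive_set AP B \<in> \<Gamma>" using B by blast
qed

lemma mcs_dead_set:
  assumes \<Gamma>: "mcs \<Gamma>" and B: "B \<subseteq> A"
  shows "dead_set AP B \<in> \<Gamma> \<longleftrightarrow> B \<inter> live \<Gamma> = {}"
proof -
  have "finite B" using B finite_agents finite_subset by blast
  then have "dead_set AP B \<in> \<Gamma> \<longleftrightarrow> (\<forall>a\<in>B. dead AP a \<in> \<Gamma>)"
    unfolding dead_set_def using B by (subst mcs_conj_list[OF \<Gamma>]) auto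
  also have "\<dots> \<longleftrightarrow> B \<inter> live \<Gamma> = {}"
    using B \<Gamma> by (auto simp: live_def alive_def mcs_Neg subset_iff)
  finally show ?thesis .
qed

text \<open>The successor omits falsity, so \<open>D B (Fls AP)\<close> fails in
  \<open>\<Gamma>\<close>; symmetry transfers this to \<open>\<Delta>\<close>.\<close>

lemma canon_live:
  assumes "mcs \<Gamma>" "mcs \<Delta>" "canon B \<Gamma> \<Delta>" "B \<noteq> {}" "B \<subseteq> A"
  shows "B \<subseteq> live \<Gamma>" "B \<subseteq> live \<Delta>"
proof -
  have *: "B \<subseteq> live \<Gamma>" if "mcs \<Gamma>" "mcs \<Delta>" "canon B \<Gamma> \<Delta>" for \<Gamma> \<Delta>
  proof -
    have "D B (Fls AP) \<notin> \<Gamma>" using that mcs_Fls by (auto simp: canon_def)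
    then have "alive_set AP B \<in> \<Gamma>" using that assms by (simp add: alive_set_def mcs_Neg)
    then show ?thesis using mcs_alive_set that assms by blast
  qed
  show "B \<subseteq> live \<Gamma>" using * assms by blast
  show "B \<subseteq> live \<Delta>" using * assms canon_sym by blast
qed

text \<open>The relation is only a partial equivalence. Where \<open>B\<close> is alive some
  successor exists, and going there and back gives reflexivity.\<close>

lemma canon_refl:
  assumes \<Gamma>: "mcs \<Gamma>" and B: "B \<noteq> {}" "B \<subseteq> live \<Gamma>"
  shows "canon B \<Gamma> \<Gamma>"
proof -
  have "B \<subseteq> A" using B live_subset by blast
  then have "alive_set AP B \<in> \<Gamma>" using mcs_alive_set[OF \<Gamma>] B by blast
  then have "D B (Fls AP) \<notin> \<Gamma>"
    using \<Gamma> B \<open>B \<subseteq> A\<close> by (simp add: alive_set_def mcs_Neg)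
  then obtain \<Delta> where "mcs \<Delta>" "canon B \<Gamma> \<Delta>"
    using canon_witness[OF \<Gamma> B(1) \<open>B \<subseteq> A\<close> Fls_LD] by blast
  then show ?thesis using canon_trans canon_sym \<Gamma> by blast
qed

text \<open>This comes from \<open>Ax_NE\<close> and later guarantees that every world is a
  non-empty simplex.\<close>

lemma live_nonempty:
  assumes "mcs \<Gamma>"
  shows "live \<Gamma> \<noteq> {}"
proof -
  have LD: "set (map (alive AP) (enum_of A)) \<subseteq> LD A AP" using finite_agents by auto
  then have "disj_list AP (map (alive AP) (enum_of A)) \<in> \<Gamma>"
    by (intro mcs_SC_axiom[OF assms Ax_NE] disj_list_LD)
  then have "set (map (alive AP) (enum_of A)) \<inter> \<Gamma> \<noteq> {}"
    using mcs_disj_list[OF assms LD] by blast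
  then show ?thesis using finite_agents by (auto simp: live_def)
qed

text \<open>By \<open>Ax_P\<close> each formula of \<open>\<Gamma>\<close> holds at every successor
  with the same dead agents. This gives one inclusion, and negation completeness turns it into
  equality.\<close>

lemma canon_live_eq:
  assumes \<Gamma>: "mcs \<Gamma>" and \<Delta>: "mcs \<Delta>" and can: "canon (live \<Gamma>) \<Gamma> \<Delta>" and eq: "live \<Delta> = live \<Gamma>"
  shows "\<Gamma> = \<Delta>"
proof -
  let ?B = "live \<Gamma>"
  have B: "?B \<noteq> {}" "?B \<subseteq> A" using live_nonempty[OF \<Gamma>] live_subset by auto
  have sub: "\<Gamma> \<subseteq> \<Delta>"
  proof
    fix \<phi> assume \<phi>: "\<phi> \<in> \<Gamma>"
    note LD = mcs_LD[OF \<Gamma> \<phi>]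
    have "Imp (Con (alive_set AP ?B) (Con (dead_set AP (A - ?B)) \<phi>))
        (D ?B (Imp (dead_set AP (A - ?B)) \<phi>)) \<in> \<Gamma>"
      using B LD by (intro mcs_SC_axiom[OF \<Gamma> Ax_P]) auto
    moreover have "alive_set AP ?B \<in> \<Gamma>" "dead_set AP (A - ?B) \<in> \<Gamma>" "dead_set AP (A - ?B) \<in> \<Delta>"
      using B eq mcs_alive_set[OF \<Gamma>] mcs_dead_set \<Gamma> \<Delta> by auto
    ultimately show "\<phi> \<in> \<Delta>"
      using \<phi> LD B \<Gamma> \<Delta> can by (auto simp: mcs_Imp mcs_Con canon_def)
  qed
  show ?thesis
  proof
    show "\<Delta> \<subseteq> \<Gamma>"
      using sub mcs_Neg[OF \<Gamma>] mcs_Neg[OF \<Delta>] mcs_LD[OF \<Delta>] by blast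
  qed (rule sub)
qed

end

section \<open>The unravelled model\<close>

text \<open>A node of the tree is the list of its edges, the last edge first; \<open>ancestor B n\<close> is the
  highest node reachable from \<open>n\<close> along edges whose groups contain \<open>B\<close>.\<close>

fun ancestor :: "'a set \<Rightarrow> ('a set \<times> 'f) list \<Rightarrow> ('a set \<times> 'f) list" where
  "ancestor B [] = []"
| "ancestor B ((C, \<phi>) # n) = (if B \<subseteq> C then ancestor B n else (C, \<phi>) # n)"

text \<open>An edge that lets \<open>B\<close> pass also lets \<open>a\<close> pass, so
  \<open>a\<close> climbs at least as far; nodes nearer the root are suffixes.\<close>

lemma suffix_ancestor_singleton: "a \<in> B \<Longrightarrow> suffix (ancestor {a} n) (ancestor B n)"
proof (induction n)
  case (Cons e n)
  have *: "suffix (ancestor {a} n) n"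
    by (induction n) (auto intro: suffix_ConsI)
  with Cons show ?case by (cases e) (auto intro: suffix_ConsI)
qed simp

text \<open>The edge that stops \<open>B\<close> lacks some agent of \<open>B\<close>, and this
  agent is stopped there too.\<close>

lemma ancestor_singleton_attained: "B \<noteq> {} \<Longrightarrow> \<exists>a\<in>B. ancestor {a} n = ancestor B n"
proof (induction n)
  case (Cons e n)
  then show ?case by (cases e) (auto simp: subset_iff)
qed auto

text \<open>This turns sharing agent by agent into sharing as a group. An agent attaining the joint
  ancestor on one side makes it a suffix of the joint ancestor on the other; doing so from both
  sides gives equality.\<close>

lemma ancestor_eqI:
  assumes "B \<noteq> {}" and eq: "\<And>a. a \<in> B \<Longrightarrow> ancestor {a} n = ancestor {a} m"
  shows "ancestor B n = ancestor B m"
proof -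
  obtain a b where "a \<in> B" "ancestor {a} n = ancestor B n" "b \<in> B" "ancestor {b} m = ancestor B m"
    using ancestor_singleton_attained[OF assms(1)] by metis
  then show ?thesis
    using suffix_ancestor_singleton[of a B m] suffix_ancestor_singleton[of b B n] eq
    by (metis suffix_order.antisym)
qed

text \<open>\<open>root\<close> is to be a maximal consistent set omitting the unprovable formula.
  \<open>emb\<close> encodes pairs of an agent and a list of edges as vertices of the given
  type.\<close>

locale SC_tree = SC_logic A AP Ax
  for A :: "'a set" and AP :: "'p set" and Ax :: "('a, 'p) fm set" +
  fixes root :: "('a, 'p) fm set" and emb :: "'a \<times> ('a set \<times> ('a, 'p) fm) list \<Rightarrow> 'v"
  assumes mcs_root: "mcs root"
    and inj_emb: "inj_on emb (A \<times> lists (Pow A \<times> LD A AP))"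
begin

section \<open>Nodes of the tree and their theories\<close>

definition witness :: "('a, 'p) fm set \<Rightarrow> 'a set \<Rightarrow> ('a, 'p) fm \<Rightarrow> ('a, 'p) fm set" where
  "witness \<Gamma> B \<phi> = (SOME \<Delta>. mcs \<Delta> \<and> canon B \<Gamma> \<Delta> \<and> \<phi> \<notin> \<Delta>)"

fun th :: "('a set \<times> ('a, 'p) fm) list \<Rightarrow> ('a, 'p) fm set" where
  "th [] = root"
| "th ((B, \<phi>) # n) = witness (th n) B \<phi>"

text \<open>\<open>th\<close> is defined on all lists, with an unspecified choice where no witness
  exists. Each edge of a node refutes a modal formula, so the choices made along it are genuine
  witnesses.\<close>

fun node :: "('a set \<times> ('a, 'p) fm) list \<Rightarrow> bool" where
  "node [] \<longleftrightarrow> True"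
| "node ((B, \<phi>) # n) \<longleftrightarrow> node n \<and> B \<noteq> {} \<and> B \<subseteq> A \<and> \<phi> \<in> LD A AP \<and> D B \<phi> \<notin> th n"

lemma witness:
  assumes "mcs \<Gamma>" "B \<noteq> {}" "B \<subseteq> A" "\<phi> \<in> LD A AP" "D B \<phi> \<notin> \<Gamma>"
  shows "mcs (witness \<Gamma> B \<phi>)" "canon B \<Gamma> (witness \<Gamma> B \<phi>)" "\<phi> \<notin> witness \<Gamma> B \<phi>"
proof -
  have "\<exists>\<Delta>. mcs \<Delta> \<and> canon B \<Gamma> \<Delta> \<and> \<phi> \<notin> \<Delta>" using canon_witness[OF assms] by blast
  from someI_ex[OF this] show "mcs (witness \<Gamma> B \<phi>)" "canon B \<Gamma> (witness \<Gamma> B \<phi>)" "\<phi> \<notin> witness \<Gamma> B \<phi>"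
    unfolding witness_def by auto
qed

lemma mcs_th: "node n \<Longrightarrow> mcs (th n)"
  by (induction n rule: node.induct) (auto simp: mcs_root witness)

lemma ancestor_lists: "node n \<Longrightarrow> ancestor B n \<in> lists (Pow A \<times> LD A AP)"
proof -
  have "node n \<Longrightarrow> n \<in> lists (Pow A \<times> LD A AP)" for n
    by (induction n rule: node.induct) auto
  then show "node n \<Longrightarrow> ancestor B n \<in> lists (Pow A \<times> LD A AP)"
    by (induction n rule: node.induct) auto
qed

text \<open>The witness relation points down the tree, so each upward step uses symmetry, and
  \<open>canon_live\<close> keeps \<open>B\<close> alive at the parent. Where the climb stops,
  \<open>canon_refl\<close> applies because \<open>B\<close> is alive.\<close>

lemma ancestor_canon:
  assumes "B \<noteq> {}"
  shows "node n \<Longrightarrow> B \<subseteq> live (th n) \<Longrightarrow> node (ancestor B n) \<and> canon B (th n) (th (ancestor B n))"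
proof (induction n rule: node.induct)
  case (2 C \<phi> n)
  show ?case
  proof (cases "B \<subseteq> C")
    case True
    let ?\<Delta> = "witness (th n) C \<phi>"
    have n: "node n" "mcs (th n)" "C \<noteq> {}" "C \<subseteq> A" "\<phi> \<in> LD A AP" "D C \<phi> \<notin> th n"
      using 2 mcs_th by auto
    note w = witness[OF n(2-)]
    have can: "canon B (th n) ?\<Delta>"
      using canon_antimono[OF n(2) w(2) True n(4)] .
    have "B \<subseteq> live (th n)"
      using canon_live(1)[OF n(2) w(1) can assms] True n by auto
    then have "node (ancestor B n)" "canon B (th n) (th (ancestor B n))" using 2 n by auto
    then show ?thesis
      using True canon_trans[OF w(1) canon_sym[OF n(2) w(1) can]] by auto
  next
    case False
    then show ?thesis using 2 canon_refl[OF mcs_th[OF "2.prems"(1)] assms] by simp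
  qed
qed (use canon_refl[OF mcs_root assms] in auto)

text \<open>Climb from \<open>n\<close> to the common ancestor of the group, then descend to
  \<open>m\<close>.\<close>

lemma shared_canon:
  assumes n: "node n" "node m" and B: "B \<noteq> {}" "B \<subseteq> live (th n)" "B \<subseteq> live (th m)"
    and eq: "\<And>a. a \<in> B \<Longrightarrow> ancestor {a} n = ancestor {a} m"
  shows "canon B (th n) (th m)"
proof -
  have "ancestor B n = ancestor B m" by (rule ancestor_eqI[OF B(1) eq])
  moreover have "node (ancestor B n)" "canon B (th n) (th (ancestor B n))"
    "canon B (th m) (th (ancestor B m))"
    using ancestor_canon[OF B(1)] n B by auto
  ultimately show ?thesis
    using canon_trans[OF mcs_th] canon_sym[OF mcs_th mcs_th] n by metis
qed

text \<open>This stands for the class of nodes connected to \<open>n\<close> by edges containing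
  \<open>a\<close>, represented by its highest node. Storing the agent lets the colour be read
  back.\<close>

definition vertex :: "'a \<Rightarrow> ('a set \<times> ('a, 'p) fm) list \<Rightarrow> 'v" where
  "vertex a n = emb (a, ancestor {a} n)"

definition world :: "('a set \<times> ('a, 'p) fm) list \<Rightarrow> 'v set" where
  "world n = (\<lambda>a. vertex a n) ` live (th n)"

definition colour_of :: "'v \<Rightarrow> 'a" where
  "colour_of v = fst (inv_into (A \<times> lists (Pow A \<times> LD A AP)) emb v)"

text \<open>Different nodes may produce the same world, so \<open>label\<close> collects the atoms
  of all of them; \<open>world_eq_imp_th_eq\<close> shows that their theories agree.\<close>

definition model :: "('a, 'p, 'v) simp_model" where
  "model = \<lparr>vertices = \<Union> (world ` Collect node),
    simplices = {X. X \<noteq> {} \<and> (\<exists>n. node n \<and> X \<subseteq> world n)},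
    colour = colour_of,
    worlds = world ` Collect node,
    label = (\<lambda>w. {p \<in> AP. \<exists>n. node n \<and> w = world n \<and> Atom p \<in> th n})\<rparr>"

lemma vertex_eq_iff:
  assumes "node n" "node m" "a \<in> A" "b \<in> A"
  shows "vertex a n = vertex b m \<longleftrightarrow> a = b \<and> ancestor {a} n = ancestor {b} m"
  unfolding vertex_def using assms ancestor_lists by (subst inj_on_eq_iff[OF inj_emb]) auto

lemma colour_vertex: "node n \<Longrightarrow> a \<in> A \<Longrightarrow> colour_of (vertex a n) = a"
  unfolding colour_of_def vertex_def using ancestor_lists
  by (subst inv_into_f_f[OF inj_emb]) auto

lemma colour_world: "node n \<Longrightarrow> colour_of ` world n = live (th n)"
  using colour_vertex live_subset by (force simp: world_def image_image)

lemma inj_on_colour: "node n \<Longrightarrow> inj_on colour_of (world n)"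
  by (rule inj_on_inverseI[of _ "\<lambda>a. vertex a n"])
    (use colour_vertex live_subset in \<open>auto simp: world_def subset_iff\<close>)

lemma vertex_in_world_iff:
  assumes "node n" "node m" "a \<in> A"
  shows "vertex a n \<in> world m \<longleftrightarrow> a \<in> live (th m) \<and> ancestor {a} n = ancestor {a} m"
  using vertex_eq_iff[OF assms(1,2,3)] live_subset by (auto simp: world_def image_iff)

lemma subset_colour_inter_iff:
  assumes "node n" "node m"
  shows "B \<subseteq> colour_of ` (world n \<inter> world m) \<longleftrightarrow>
    B \<subseteq> live (th n) \<and> B \<subseteq> live (th m) \<and> (\<forall>a\<in>B. ancestor {a} n = ancestor {a} m)"
proof -
  have "a \<in> colour_of ` (world n \<inter> world m) \<longleftrightarrow>
    a \<in> live (th n) \<and> a \<in> live (th m) \<and> ancestor {a} n = ancestor {a} m" for a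
  proof
    assume "a \<in> colour_of ` (world n \<inter> world m)"
    then obtain v where v: "v \<in> world n" "v \<in> world m" "a = colour_of v" by auto
    then obtain b where b: "b \<in> live (th n)" "v = vertex b n" by (auto simp: world_def)
    then have "b \<in> A" using live_subset by auto
    then have "a = b" using v b colour_vertex assms by auto
    then show "a \<in> live (th n) \<and> a \<in> live (th m) \<and> ancestor {a} n = ancestor {a} m"
      using vertex_in_world_iff[OF assms \<open>b \<in> A\<close>] v b by auto
  next
    assume *: "a \<in> live (th n) \<and> a \<in> live (th m) \<and> ancestor {a} n = ancestor {a} m"
    then have "a \<in> A" using live_subset by auto
    have "vertex a n \<in> world n \<inter> world m"
      using * vertex_in_world_iff[OF assms \<open>a \<in> A\<close>] by (auto simp: world_def)
    then show "a \<in> colour_of ` (world n \<inter> world m)"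
      using colour_vertex[OF assms(1) \<open>a \<in> A\<close>] by force
  qed
  then show ?thesis by blast
qed

text \<open>Inclusion means that all live agents of \<open>n\<close> share their vertices with
  \<open>m\<close>, so \<open>shared_canon\<close> applies to the whole live set.\<close>

lemma world_subset:
  assumes n: "node n" "node m" and sub: "world n \<subseteq> world m"
  shows "live (th n) \<subseteq> live (th m)" "canon (live (th n)) (th n) (th m)"
proof -
  have "live (th n) \<subseteq> colour_of ` (world n \<inter> world m)"
    using sub colour_world[OF n(1)] by (simp add: Int_absorb2)
  then have *: "live (th n) \<subseteq> live (th m)" "\<forall>a\<in>live (th n). ancestor {a} n = ancestor {a} m"
    using subset_colour_inter_iff[OF n] by auto
  then show "live (th n) \<subseteq> live (th m)" by blast
  show "canon (live (th n)) (th n) (th m)"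
    using * n live_nonempty[OF mcs_th] by (intro shared_canon) auto
qed

lemma world_eq_imp_th_eq:
  assumes "node n" "node m" "world n = world m"
  shows "th n = th m"
proof -
  have "live (th m) = live (th n)"
    using world_subset(1)[OF assms(1,2)] world_subset(1)[OF assms(2,1)] assms(3) by blast
  then show ?thesis
    using canon_live_eq[OF mcs_th mcs_th world_subset(2)] assms by blast
qed

text \<open>If \<open>D B \<phi>\<close> is missing from \<open>th n\<close>, the child along the
  edge \<open>(B, \<phi>)\<close> refutes it. If it is present, \<open>shared_canon\<close> carries
  \<open>\<phi>\<close> to every world sharing the vertices of \<open>B\<close>.\<close>

lemma truth:
  "\<phi> \<in> LD A AP \<Longrightarrow> node n \<Longrightarrow> sat model (world n) \<phi> \<longleftrightarrow> \<phi> \<in> th n"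
proof (induction \<phi> arbitrary: n rule: LD.induct)
  case (1 p)
  have "sat model (world n) (Atom p) \<longleftrightarrow> (\<exists>m. node m \<and> world n = world m \<and> Atom p \<in> th m)"
    using 1 by (simp add: model_def)
  also have "\<dots> \<longleftrightarrow> Atom p \<in> th n"
    using world_eq_imp_th_eq[OF \<open>node n\<close>] \<open>node n\<close> by metis
  finally show ?case .
next
  case (4 B \<phi>)
  note n = \<open>node n\<close>
  have "sat model (world n) (D B \<phi>) \<longleftrightarrow>
    (\<forall>m. node m \<longrightarrow> B \<subseteq> colour_of ` (world n \<inter> world m) \<longrightarrow> \<phi> \<in> th m)"
    using "4.IH" by (simp add: model_def)
  also have "\<dots> \<longleftrightarrow> D B \<phi> \<in> th n"
  proof
    assume *: "\<forall>m. node m \<longrightarrow> B \<subseteq> colour_of ` (world n \<inter> world m) \<longrightarrow> \<phi> \<in> th m"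
    show "D B \<phi> \<in> th n"
    proof (rule ccontr)
      assume "D B \<phi> \<notin> th n"
      then have child: "node ((B, \<phi>) # n)" using 4 by auto
      note w = witness[OF mcs_th[OF n] "4.hyps"(1,2,3) \<open>D B \<phi> \<notin> th n\<close>]
      \<comment> \<open>Every agent of \<open>B\<close> climbs over the new edge, so its ancestor is
        the same from the child as from \<open>n\<close>.\<close>
      have "B \<subseteq> colour_of ` (world n \<inter> world ((B, \<phi>) # n))"
        using canon_live[OF mcs_th[OF n] w(1,2) "4.hyps"(1,2)] subset_colour_inter_iff[OF n child]
        by auto
      then have "\<phi> \<in> th ((B, \<phi>) # n)" using * child by blast
      then show False using w(3) by simp
    qed
  next
    assume "D B \<phi> \<in> th n"
    then show "\<forall>m. node m \<longrightarrow> B \<subseteq> colour_of ` (world n \<inter> world m) \<longrightarrow> \<phi> \<in> th m"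
      using shared_canon[OF n] subset_colour_inter_iff[OF n] "4.hyps"(1) by (auto simp: canon_def)
  qed
  finally show ?case .
qed (auto simp: mcs_Neg mcs_Con mcs_th)

lemma world_simplex: "node n \<Longrightarrow> world n \<in> simplices model"
  using live_nonempty[OF mcs_th] by (auto simp: model_def world_def)

section \<open>Membership in the model classes\<close>

lemma generalized_model: "generalized_model A AP model"
proof -
  have "chromatic_complex A (vertices model) (simplices model) (colour model)"
    unfolding chromatic_complex_def
  proof (intro conjI ballI allI impI)
    show "Y \<in> simplices model" if "X \<in> simplices model" "Y \<noteq> {} \<and> Y \<subseteq> X" for X Y
      using that unfolding model_def by (simp, meson subset_trans)
    show "colour model ` vertices model \<subseteq> A"
      using colour_world live_subset by (auto simp: model_def)
    show "inj_on (colour model) X" if "X \<in> simplices model" for X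
      using that inj_on_colour inj_on_subset by (auto simp: model_def)
  qed (auto simp: model_def)
  moreover have "facets (simplices model) \<subseteq> worlds model"
  proof
    fix X assume X: "X \<in> facets (simplices model)"
    then obtain n where "node n" "X \<subseteq> world n" by (auto simp: facets_def model_def)
    then have "X = world n" using X world_simplex by (auto simp: facets_def)
    then show "X \<in> worlds model" using \<open>node n\<close> by (auto simp: model_def)
  qed
  moreover have "worlds model \<subseteq> simplices model"
    using world_simplex by (auto simp: model_def)
  ultimately show ?thesis
    by (auto simp: generalized_model_def model_def)
qed

lemma minimal_model:
  assumes Min: "Min_axioms A AP \<subseteq> Ax"
  shows "minimal_model A AP model"
proof -
  \<comment> \<open>The extra axiom transports the deadness of the absent agents to the larger
    world. Both worlds then have the same colours, and colours are injective on a world.\<close>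
  have max: "world n = world m" if n: "node n" "node m" and sub: "world n \<subseteq> world m" for n m
  proof -
    let ?B = "live (th n)"
    note \<Gamma> = mcs_th[OF n(1)] and \<Delta> = mcs_th[OF n(2)]
    have B: "?B \<noteq> {}" "?B \<subseteq> A" using live_nonempty[OF \<Gamma>] live_subset by auto
    note * = world_subset[OF n sub]
    have "live (th m) \<subseteq> ?B"
    proof (cases "?B = A")
      case False
      let ?d = "dead_set AP (A - ?B)"
      have "Imp (Con (alive_set AP ?B) ?d) (D ?B ?d) \<in> th n"
        using B False Min by (intro mcs_axiom[OF \<Gamma>]) (auto simp: Min_axioms_def)
      moreover have "alive_set AP ?B \<in> th n" "?d \<in> th n"
        using B mcs_alive_set[OF \<Gamma>] mcs_dead_set[OF \<Gamma>] by auto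
      ultimately have "?d \<in> th m"
        using *(2) B \<Gamma> by (simp add: mcs_Imp mcs_Con canon_def)
      then show ?thesis
        using mcs_dead_set[OF \<Delta>, of "A - ?B"] live_subset[of "th m"] by auto
    qed (use live_subset in auto)
    then have "colour_of ` world m = colour_of ` world n"
      using * colour_world n by auto
    then show "world n = world m"
      using sub inj_on_image_eq_iff[OF inj_on_colour[OF n(2)], of "world n" "world m"] by auto
  qed
  have "worlds model \<subseteq> facets (simplices model)"
  proof
    fix X assume "X \<in> worlds model"
    then obtain n where n: "node n" "X = world n" by (auto simp: model_def)
    have "Y = X" if Y: "Y \<in> simplices model" "X \<subseteq> Y" for Y
    proof -
      obtain m where "node m" "Y \<subseteq> world m" using Y by (auto simp: model_def)
      then show ?thesis using max[of n m] Y n by auto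
    qed
    then show "X \<in> facets (simplices model)"
      using n world_simplex by (auto simp: facets_def)
  qed
  then show ?thesis
    using generalized_model by (auto simp: minimal_model_def generalized_model_def)
qed

text \<open>For a face with colours \<open>B\<close>, the extra axiom refutes
  \<open>D B (Neg ?d)\<close>, where \<open>?d\<close> says that the agents outside \<open>B\<close>
  are dead. The corresponding child has exactly the live agents \<open>B\<close>, and its edge
  preserves their vertices.\<close>

lemma maximal_model:
  assumes Max: "Max_axioms A AP \<subseteq> Ax"
  shows "maximal_model A AP model"
proof -
  have "X \<in> worlds model" if X: "X \<in> simplices model" for X
  proof -
    obtain n where n: "node n" "X \<subseteq> world n" "X \<noteq> {}" using X by (auto simp: model_def)
    note \<Gamma> = mcs_th[OF n(1)]
    obtain B where B: "B \<subseteq> live (th n)" "X = (\<lambda>a. vertex a n) ` B"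
      using n(2) by (auto simp: world_def subset_image_iff)
    have BA: "B \<noteq> {}" "B \<subseteq> A" using B n(3) live_subset by auto
    show ?thesis
    \<comment> \<open>The axiom covers proper subsets only; a face with all colours is the whole
      world.\<close>
    proof (cases "B = A")
      case True
      then have "X = world n" using B live_subset[of "th n"] by (auto simp: world_def)
      then show ?thesis using n by (auto simp: model_def)
    next
      case False
      let ?d = "dead_set AP (A - B)"
      have "Imp (alive_set AP B) (Neg (D B (Neg ?d))) \<in> th n"
        using BA False Max by (intro mcs_axiom[OF \<Gamma>]) (auto simp: Max_axioms_def)
      moreover have "alive_set AP B \<in> th n"
        using BA B mcs_alive_set[OF \<Gamma>] by auto
      ultimately have nD: "D B (Neg ?d) \<notin> th n"
        using BA \<Gamma> by (simp add: mcs_Imp mcs_Neg)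
      let ?m = "(B, Neg ?d) # n"
      have m: "node ?m" using n(1) BA nD by simp
      have w: "mcs (th ?m)" "canon B (th n) (th ?m)" "Neg ?d \<notin> th ?m"
        using witness[OF \<Gamma> BA _ nD] by auto
      have "?d \<in> th ?m" using w(3) mcs_Neg[OF w(1), of ?d] by auto
      then have "live (th ?m) \<subseteq> B"
        using mcs_dead_set[OF w(1), of "A - B"] live_subset[of "th ?m"] by auto
      then have "live (th ?m) = B"
        using canon_live(2)[OF \<Gamma> w(1,2) BA] by auto
      then have "X = world ?m"
        unfolding world_def B(2) by (auto simp: vertex_def)
      then show ?thesis using m by (auto simp: model_def)
    qed
  qed
  then show ?thesis
    using generalized_model by (auto simp: maximal_model_def generalized_model_def)
qed

end

section \<open>Completeness\<close>

text \<open>One construction serves both systems: the extra axioms contained in \<open>Ax\<close>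
  decide to which class the model belongs.\<close>

lemma countermodel:
  fixes A :: "'a set" and AP :: "'p set"
  assumes "finite A" "countable AP" "infinite (UNIV :: 'v set)"
    and "SC_axioms A AP \<subseteq> Ax" and \<phi>: "\<phi> \<in> LD A AP" "\<phi> \<notin> theorems_of A AP Ax"
  obtains C :: "('a, 'p, 'v) simp_model" and w where
    "Min_axioms A AP \<subseteq> Ax \<Longrightarrow> minimal_model A AP C"
    "Max_axioms A AP \<subseteq> Ax \<Longrightarrow> maximal_model A AP C"
    "w \<in> worlds C" "\<not> sat C w \<phi>"
proof -
  interpret SC_logic A AP Ax
    using assms AP_nonempty_if_LD by unfold_locales auto
  obtain \<Gamma> where \<Gamma>: "mcs \<Gamma>" "\<phi> \<notin> \<Gamma>"
    using lindenbaum[OF theory_thms \<phi>(1)] \<phi>(2) by blast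
  let ?X = "A \<times> lists (Pow A \<times> LD A AP)"
  have "countable ?X"
    using assms countable_LD[OF assms(1,2)]
    by (intro countable_SIGMA countable_lists) (auto intro: countable_finite)
  \<comment> \<open>An infinite type contains a copy of the natural numbers, into which the
    countably many possible vertices are encoded.\<close>
  moreover obtain g :: "nat \<Rightarrow> 'v" where "inj g"
    using infinite_countable_subset[OF assms(3)] by auto
  ultimately have "inj_on (g \<circ> to_nat_on ?X) ?X"
    by (intro comp_inj_on inj_on_to_nat_on) (auto intro: inj_on_subset)
  then interpret SC_tree A AP Ax \<Gamma> "g \<circ> to_nat_on ?X"
    using \<Gamma> by unfold_locales
  show ?thesis
  proof
    show "world [] \<in> worlds model" by (auto simp: model_def)
    show "\<not> sat model (world []) \<phi>" using truth[OF \<phi>(1), of "[]"] \<Gamma> by simp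
  qed (fact minimal_model maximal_model)+
qed

theorem theorem50:
  fixes A :: "'a set" and AP :: "'p set"
  assumes "finite A" and "countable AP" and "infinite (UNIV :: 'v set)"
  shows "(\<forall>\<phi>\<in>LD A AP.
            (\<forall>C :: ('a, 'p, 'v) simp_model. minimal_model A AP C \<longrightarrow> (\<forall>w\<in>worlds C. sat C w \<phi>))
            \<longrightarrow> \<phi> \<in> SC_min A AP) \<and>
         (\<forall>\<phi>\<in>LD A AP.
            (\<forall>C :: ('a, 'p, 'v) simp_model. maximal_model A AP C \<longrightarrow> (\<forall>w\<in>worlds C. sat C w \<phi>))
            \<longrightarrow> \<phi> \<in> SC_max A AP)"
proof (intro conjI ballI impI)
  fix \<phi> :: "('a, 'p) fm" assume \<phi>: "\<phi> \<in> LD A AP"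
    and valid: "\<forall>C :: ('a, 'p, 'v) simp_model. minimal_model A AP C \<longrightarrow> (\<forall>w\<in>worlds C. sat C w \<phi>)"
  show "\<phi> \<in> SC_min A AP"
  proof (rule ccontr)
    assume "\<phi> \<notin> SC_min A AP"
    from countermodel[OF assms _ \<phi> this[unfolded SC_min_def]] valid show False
      by (metis Un_upper1 Un_upper2)
  qed
next
  fix \<phi> :: "('a, 'p) fm" assume \<phi>: "\<phi> \<in> LD A AP"
    and valid: "\<forall>C :: ('a, 'p, 'v) simp_model. maximal_model A AP C \<longrightarrow> (\<forall>w\<in>worlds C. sat C w \<phi>)"
  show "\<phi> \<in> SC_max A AP"
  proof (rule ccontr)
    assume "\<phi> \<notin> SC_max A AP"
    from countermodel[OF assms _ \<phi> this[unfolded SC_max_def]] valid show False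
      by (metis Un_upper1 Un_upper2)
  qed
qed

end
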